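(* Let $\phi:[0,\infty[\to[0,\infty[$ be of class $C^2$ with $\phi'>0$ on $[0,\infty[$, such that $r\phi'(r)\to\infty$ as $r\to\infty$, and such that for some constants $R_0\ge0$ and $0<\delta<1$ we have $\phi''(r)\le(1-\delta)\phi'(r)^2$ for all $r\in[R_0,\infty[$. Then $v(r):=e^{-\phi(r)}$ is a weight, and there are constants $R>0$, $C>0$ and $0<\delta'\le1$ such that on $]R,\infty[$ the function $r\mapsto|v'(r)|\,r^{1+\delta'}$ is non-increasing and $-\frac{v(r)v''(r)}{v'(r)^2}\le C$. In addition, if there exist constants $r_0,c>0$ such that $$\phi'(r)+r\phi''(r)\ge\frac{c}{r}\quad\text{for all } r\ge r_0,$$ then $v$ is also essential.
   Context: $H(\mathbb{C})$ is the space of entire functions. A weight is a continuous non-increasing function $v:[0,\infty[\to]0,\infty[$ with $\lim_{r\to\infty}r^mv(r)=0$ for each $m\in\mathbb{N}$; it is extended to $\mathbb{C}$ by $v(z):=v(|z|)$. For a weight $v$, $H^\infty_v(\mathbb{C})=\{f\in H(\mathbb{C}):\|f\|_v:=\sup_{z\in\mathbb{C}}v(|z|)|f(z)|<\infty\}$. The associated weight is $\tilde v(z):=\big(\sup\{|f(z)|:f\in H^\infty_v(\mathbb{C}),\ \|f\|_v\le1\}\big)^{-1}$, $z\in\mathbb{C}$. A weight $v$ is called essential if there is $C>0$ such that $v(z)\le\tilde v(z)\le Cv(z)$ for each $z\in\mathbb{C}$. *)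

theory Defs
  imports "HOL-Complex_Analysis.Complex_Analysis"
begin

text \<open>Functions on the half-line \<open>[0,\<infinity>[\<close> are represented by total functions on the reals,
  whose values at negative arguments are irrelevant. A weight \<open>v\<close> is extended to the complex
  plane by \<open>z \<mapsto> v (cmod z)\<close>.\<close>

definition weight :: "(real \<Rightarrow> real) \<Rightarrow> bool" where
  "weight v \<longleftrightarrow>
     continuous_on {0..} v \<and>
     (\<forall>r\<ge>0. v r > 0) \<and>
     antimono_on {0..} v \<and>
     (\<forall>m::nat. ((\<lambda>r. r ^ m * v r) \<longlongrightarrow> 0) at_top)"

definition Hv :: "(real \<Rightarrow> real) \<Rightarrow> (complex \<Rightarrow> complex) set" where
  "Hv v = {f. f holomorphic_on UNIV \<and> bdd_above (range (\<lambda>z. v (cmod z) * cmod (f z)))}"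

text \<open>The supremum is taken in the reals, so it is meaningful only for members of \<open>Hv v\<close>.\<close>

definition v_norm :: "(real \<Rightarrow> real) \<Rightarrow> (complex \<Rightarrow> complex) \<Rightarrow> real" where
  "v_norm v f = (SUP z. v (cmod z) * cmod (f z))"

text \<open>For a weight, the set below is bounded above by \<open>1 / v (cmod z)\<close> and contains the modulus
  of a nonzero constant, so its real supremum is finite and positive.\<close>

definition associated_weight :: "(real \<Rightarrow> real) \<Rightarrow> complex \<Rightarrow> real" where
  "associated_weight v z = inverse (Sup {cmod (f z) | f. f \<in> Hv v \<and> v_norm v f \<le> 1})"

definition essential :: "(real \<Rightarrow> real) \<Rightarrow> bool" where
  "essential v \<longleftrightarrow>
     weight v \<and>
     (\<exists>C>0. \<forall>z. v (cmod z) \<le> associated_weight v z \<and> associated_weight v z \<le> C * v (cmod z))"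

text \<open>\<open>f\<close> is of class \<open>C\<^sup>2\<close> on the closed half-line with first and second derivatives \<open>f'\<close> and
  \<open>f''\<close>; the derivatives at \<open>0\<close> are one-sided.\<close>

definition C2_halfline :: "(real \<Rightarrow> real) \<Rightarrow> (real \<Rightarrow> real) \<Rightarrow> (real \<Rightarrow> real) \<Rightarrow> bool" where
  "C2_halfline f f' f'' \<longleftrightarrow>
     (\<forall>r\<ge>0. (f has_real_derivative f' r) (at r within {0..})) \<and>
     (\<forall>r\<ge>0. (f' has_real_derivative f'' r) (at r within {0..})) \<and>
     continuous_on {0..} f''"

end

theory Submission
  imports Defs
begin

text \<open>Everything rests on the variable \<open>u = ln r\<close>: the derivative of \<open>\<phi>(e\<^sup>u)\<close> is \<open>r \<phi>'(r)\<close>.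
  That this tends to infinity means that \<open>\<phi>\<close> eventually grows faster than every multiple of
  \<open>ln r\<close>, which is the decay required of a weight.

  The bound on \<open>\<phi>''\<close> gives the regularity of \<open>v = e\<^sup>-\<^sup>\<phi>\<close> by differentiation. For large \<open>r\<close>,
  \<open>- v v'' / v'\<^sup>2 = \<phi>'' / \<phi>'\<^sup>2 - 1 \<le> - \<delta>\<close>, and the logarithmic derivative of \<open>\<bar>v'\<bar> r\<^sup>2\<close> is
  \<open>\<phi>'' / \<phi>' - \<phi>' + 2 / r \<le> - \<delta> \<phi>' + 2 / r\<close>, which is at most \<open>0\<close> once \<open>r \<phi>'(r) \<ge> 2 / \<delta>\<close>. So
  \<open>\<delta>' = 1\<close> can be taken.

  For essentiality, \<open>\<phi>' + r \<phi>'' \<ge> c / r\<close> says that the second derivative of \<open>\<phi>(e\<^sup>u)\<close> is at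
  least \<open>c\<close> for \<open>e\<^sup>u \<ge> r0\<close>. Hence \<open>\<phi>(e\<^sup>u)\<close> stays there above its tangent at \<open>ln r\<close> plus a parabola (lemma
  \<open>log_uniformly_convex_above_parabola\<close>). If the slope \<open>r \<phi>'(r)\<close> of the tangent were an integer
  \<open>n\<close>, this would say that a multiple of \<open>\<bar>z\<bar>\<^sup>n\<close> lies below \<open>e\<^sup>\<phi>\<close> for \<open>\<bar>z\<bar> \<ge> r0\<close> and touches it at
  radius \<open>r\<close>.
  Rounding the slope down to an integer changes the tangent by at most \<open>\<bar>u - ln r\<bar>\<close>, and
  the parabola absorbs this up to the constant \<open>1 / (2 c)\<close>. So for large \<open>r\<close> suitable
  monomials attain the supremum in the associated weight up to a fixed factor; for small \<open>r\<close>
  the constant \<open>1\<close> does.\<close>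

section \<open>Growth and the weight property\<close>

lemma C2_halfline_DERIV:
  assumes "C2_halfline f f' f''" "r > 0"
  shows "(f has_real_derivative f' r) (at r)" "(f' has_real_derivative f'' r) (at r)"
proof -
  have "at r within {0..} = at r"
    using assms(2) by (intro at_within_interior) (simp add: interior_real_atLeast)
  then show "(f has_real_derivative f' r) (at r)" "(f' has_real_derivative f'' r) (at r)"
    using assms unfolding C2_halfline_def by (metis less_imp_le)+
qed

lemma C2_halfline_continuous_on: "C2_halfline f f' f'' \<Longrightarrow> continuous_on {0..} f"
  unfolding C2_halfline_def by (auto intro: DERIV_continuous_on)

lemma C2_halfline_mono_on:
  assumes f: "C2_halfline f f' f''" and pos: "\<And>r. r > 0 \<Longrightarrow> f' r > 0"
  shows "mono_on {0..} f"
proof (rule mono_onI)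
  fix a b :: real assume ab: "a \<in> {0..}" "a \<le> b"
  show "f a \<le> f b"
  proof (cases "a < b")
    case True
    have "continuous_on {a..b} f"
      using C2_halfline_continuous_on[OF f] ab by (auto intro: continuous_on_subset)
    moreover have "\<exists>y. (f has_real_derivative y) (at x) \<and> y > 0" if "a < x" "x < b" for x
      using C2_halfline_DERIV(1)[OF f, of x] pos[of x] that ab by auto
    ultimately show ?thesis
      using DERIV_pos_imp_increasing_open[OF True, of f] by fastforce
  qed (use ab in simp)
qed

text \<open>Where \<open>r f'(r) \<ge> p + 1\<close>, the function \<open>f - (p + 1) ln\<close> is nondecreasing, so that
  \<open>f - p ln\<close> exceeds \<open>ln\<close> up to a constant.\<close>

lemma faster_than_log:
  fixes f f' :: "real \<Rightarrow> real" and p :: real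
  assumes f: "\<And>r. r > 0 \<Longrightarrow> (f has_real_derivative f' r) (at r)"
    and lim: "filterlim (\<lambda>r. r * f' r) at_top at_top"
  shows "filterlim (\<lambda>r. f r - p * ln r) at_top at_top"
proof -
  obtain a where a: "a > 0" "\<And>r. r \<ge> a \<Longrightarrow> r * f' r \<ge> p + 1"
  proof -
    obtain b where "\<And>r. r \<ge> b \<Longrightarrow> r * f' r \<ge> p + 1"
      using lim unfolding filterlim_at_top eventually_at_top_linorder by metis
    then show thesis by (intro that[of "max b 1"]) auto
  qed
  define K where "K = f a - (p + 1) * ln a"
  have "K \<le> f r - (p + 1) * ln r" if "a \<le> r" for r
    unfolding K_def
  proof (rule DERIV_nonneg_imp_nondecreasing[OF that])
    fix x assume x: "a \<le> x" "x \<le> r"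
    then have "((\<lambda>r. f r - (p + 1) * ln r) has_real_derivative f' x - (p + 1) * (1 / x)) (at x)"
      using a by (auto intro!: derivative_eq_intros f simp: divide_simps)
    moreover have "f' x - (p + 1) * (1 / x) \<ge> 0"
      using a(1) a(2)[OF x(1)] x(1) by (simp add: field_simps)
    ultimately show "\<exists>y. ((\<lambda>r. f r - (p + 1) * ln r) has_real_derivative y) (at x) \<and> 0 \<le> y"
      by blast
  qed
  then have below: "eventually (\<lambda>r. K + ln r \<le> f r - p * ln r) at_top"
    unfolding eventually_at_top_linorder by (intro exI[of _ a]) (auto simp: algebra_simps)
  have "filterlim (\<lambda>r. K + ln r) at_top at_top"
    by (rule filterlim_tendsto_add_at_top[OF tendsto_const ln_at_top])
  then show ?thesis
    by (rule filterlim_at_top_mono[OF _ below])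
qed

lemma weight_exp_minus:
  assumes phi: "C2_halfline phi phi' phi''"
    and pos: "\<And>r. r > 0 \<Longrightarrow> phi' r > 0"
    and lim: "filterlim (\<lambda>r. r * phi' r) at_top at_top"
    and v: "\<And>r. r \<ge> 0 \<Longrightarrow> v r = exp (- phi r)"
  shows "weight v"
  unfolding weight_def
proof (intro conjI allI impI)
  have "continuous_on {0..} (\<lambda>r. exp (- phi r))"
    by (intro continuous_intros C2_halfline_continuous_on[OF phi])
  then show "continuous_on {0..} v"
    by (rule continuous_on_eq) (simp add: v)
  show "v r > 0" if "r \<ge> 0" for r
    using v that by simp
  show "antimono_on {0..} v"
    using C2_halfline_mono_on[OF phi pos]
    by (auto simp: monotone_on_def v)
  fix m :: nat
  have "((\<lambda>r. exp (- (phi r - real m * ln r))) \<longlongrightarrow> 0) at_top"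
    using faster_than_log[OF C2_halfline_DERIV(1)[OF phi] lim, of "real m"]
    by (intro filterlim_compose[OF exp_at_bot]) (simp add: filterlim_uminus_at_top)
  moreover have "eventually (\<lambda>r. exp (- (phi r - real m * ln r)) = r ^ m * v r) at_top"
    using eventually_gt_at_top[of 0]
    by eventually_elim
      (simp add: v exp_diff exp_minus ln_realpow[symmetric] field_simps)
  ultimately show "((\<lambda>r. r ^ m * v r) \<longlongrightarrow> 0) at_top"
    by (rule Lim_transform_eventually)
qed

section \<open>Derivatives of the weight\<close>

lemma deriv_exp_minus:
  assumes phi: "C2_halfline phi phi' phi''"
    and v: "\<And>r. r \<ge> 0 \<Longrightarrow> v r = exp (- phi r)"
    and r: "r > 0"
  shows "deriv v r = - phi' r * exp (- phi r)"
    and "deriv (deriv v) r = ((phi' r)\<^sup>2 - phi'' r) * exp (- phi r)"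
proof -
  have 1: "deriv v x = - phi' x * exp (- phi x)" if "x > 0" for x
  proof -
    have "((\<lambda>r. exp (- phi r)) has_real_derivative - phi' x * exp (- phi x)) (at x)"
      by (auto intro!: derivative_eq_intros C2_halfline_DERIV(1)[OF phi that])
    then have "(v has_real_derivative - phi' x * exp (- phi x)) (at x)"
      by (rule has_field_derivative_transform_within_open[where S = "{0<..}"])
        (use v that in auto)
    then show ?thesis
      by (rule DERIV_imp_deriv)
  qed
  show "deriv v r = - phi' r * exp (- phi r)"
    by (rule 1[OF r])
  have "((\<lambda>r. - phi' r * exp (- phi r)) has_real_derivative
      ((phi' r)\<^sup>2 - phi'' r) * exp (- phi r)) (at r)"
    by (auto intro!: derivative_eq_intros C2_halfline_DERIV[OF phi r]
        simp: power2_eq_square algebra_simps)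
  then have "(deriv v has_real_derivative ((phi' r)\<^sup>2 - phi'' r) * exp (- phi r)) (at r)"
    by (rule has_field_derivative_transform_within_open[where S = "{0<..}"])
      (use 1 r in auto)
  then show "deriv (deriv v) r = ((phi' r)\<^sup>2 - phi'' r) * exp (- phi r)"
    by (rule DERIV_imp_deriv)
qed

text \<open>For \<open>r \<ge> R0\<close>, the derivative of \<open>\<phi>' e\<^sup>-\<^sup>\<phi> r\<^sup>2\<close> is
  \<open>r e\<^sup>-\<^sup>\<phi> (r (\<phi>'' - \<phi>'\<^sup>2) + 2 \<phi>') \<le> r e\<^sup>-\<^sup>\<phi> \<phi>' (2 - \<delta> r \<phi>')\<close>.\<close>

lemma regularity_exp_minus:
  assumes phi: "C2_halfline phi phi' phi''"
    and pos: "\<And>r. r > 0 \<Longrightarrow> phi' r > 0"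
    and lim: "filterlim (\<lambda>r. r * phi' r) at_top at_top"
    and delta: "0 < \<delta>"
    and phi''_le: "\<And>r. r \<ge> R0 \<Longrightarrow> phi'' r \<le> (1 - \<delta>) * (phi' r)\<^sup>2"
    and v: "\<And>r. r \<ge> 0 \<Longrightarrow> v r = exp (- phi r)"
  obtains R where "R > 0" "antimono_on {R<..} (\<lambda>r. \<bar>deriv v r\<bar> * r\<^sup>2)"
    "\<And>r. r > R \<Longrightarrow> - (v r * deriv (deriv v) r / (deriv v r)\<^sup>2) \<le> - \<delta>"
proof -
  obtain b where b: "\<And>r. r \<ge> b \<Longrightarrow> r * phi' r \<ge> 2 / \<delta>"
    using lim unfolding filterlim_at_top eventually_at_top_linorder by metis
  define R where "R = max 1 (max b R0)"
  have R: "R > 0" "R \<ge> b" "R \<ge> R0"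
    by (auto simp: R_def)
  define F where "F = (\<lambda>r. phi' r * exp (- phi r) * r\<^sup>2)"
  have F: "\<bar>deriv v r\<bar> * r\<^sup>2 = F r" if "r > R" for r
    using deriv_exp_minus(1)[OF phi v, of r] pos[of r] that R(1) by (simp add: F_def abs_mult)
  have F_anti: "F b \<le> F a" if ab: "R < a" "a \<le> b" for a b
  proof (rule DERIV_nonpos_imp_nonincreasing[OF ab(2)])
    fix x assume "a \<le> x" "x \<le> b"
    then have x: "x > 0" "x > R" using R ab by auto
    define D where "D = exp (- phi x) * x * (x * (phi'' x - (phi' x)\<^sup>2) + 2 * phi' x)"
    have "(F has_real_derivative D) (at x)"
      unfolding F_def D_def
      by (auto intro!: derivative_eq_intros C2_halfline_DERIV[OF phi x(1)]
          simp: power2_eq_square algebra_simps)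
    moreover have "D \<le> 0"
    proof -
      have "x * (phi'' x - (phi' x)\<^sup>2) \<le> x * (- \<delta> * (phi' x)\<^sup>2)"
        using phi''_le[of x] x R by (intro mult_left_mono) (auto simp: algebra_simps)
      then have "x * (phi'' x - (phi' x)\<^sup>2) + 2 * phi' x \<le> phi' x * (2 - \<delta> * (x * phi' x))"
        by (simp add: algebra_simps power2_eq_square)
      also have "\<dots> \<le> 0"
        using b[of x] x R delta pos[of x]
        by (intro mult_nonneg_nonpos) (auto simp: field_simps)
      finally show ?thesis
        unfolding D_def using x by (intro mult_nonneg_nonpos) auto
    qed
    ultimately show "\<exists>y. (F has_real_derivative y) (at x) \<and> y \<le> 0"
      by blast
  qed
  show thesis
  proof (rule that[OF R(1)])
    show "antimono_on {R<..} (\<lambda>r. \<bar>deriv v r\<bar> * r\<^sup>2)"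
      using F F_anti by (auto simp: monotone_on_def)
    fix r assume r: "r > R"
    then have r0: "r > 0" and "phi'' r \<le> (1 - \<delta>) * (phi' r)\<^sup>2" "phi' r > 0"
      using R phi''_le pos by auto
    then have "phi'' r / (phi' r)\<^sup>2 - 1 \<le> - \<delta>"
      by (simp add: field_simps)
    moreover have "- (v r * deriv (deriv v) r / (deriv v r)\<^sup>2) = phi'' r / (phi' r)\<^sup>2 - 1"
      using deriv_exp_minus[OF phi v r0] v[of r] r0 \<open>phi' r > 0\<close>
      by (simp add: field_simps power2_eq_square)
    ultimately show "- (v r * deriv (deriv v) r / (deriv v r)\<^sup>2) \<le> - \<delta>"
      by simp
  qed
qed

section \<open>Essential weights\<close>

text \<open>Every \<open>f\<close> in the unit ball has modulus at most \<open>1 / v\<close>, so \<open>v\<close> never exceeds its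
  associated weight. Essentiality thus amounts to having, at each point, a test function in the
  unit ball that comes within a fixed factor of the extremal value \<open>1 / v\<close>.\<close>

lemma essentialI:
  assumes v: "weight v" and C: "C > 0"
    and test: "\<And>z. \<exists>f. f holomorphic_on UNIV \<and> (\<forall>w. v (cmod w) * cmod (f w) \<le> 1) \<and>
      1 \<le> C * v (cmod z) * cmod (f z)"
  shows "essential v"
  unfolding essential_def
proof (intro conjI exI[of _ C] allI)
  fix z :: complex
  define S where "S = {cmod (f z) | f. f \<in> Hv v \<and> v_norm v f \<le> 1}"
  have v_pos: "v (cmod z) > 0"
    using v by (simp add: weight_def)
  have upper: "x \<le> 1 / v (cmod z)" if "x \<in> S" for x
  proof -
    obtain f where f: "x = cmod (f z)" "f \<in> Hv v" "v_norm v f \<le> 1"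
      using \<open>x \<in> S\<close> unfolding S_def by blast
    have "v (cmod z) * cmod (f z) \<le> v_norm v f"
      using f(2) unfolding v_norm_def Hv_def by (intro cSUP_upper) auto
    then show ?thesis
      using f v_pos by (simp add: field_simps)
  qed
  obtain f where f: "f holomorphic_on UNIV" "\<And>w. v (cmod w) * cmod (f w) \<le> 1"
      "1 \<le> C * v (cmod z) * cmod (f z)"
    using test by blast
  have fS: "cmod (f z) \<in> S"
  proof -
    have "v_norm v f \<le> 1"
      unfolding v_norm_def by (rule cSUP_least) (use f in auto)
    moreover have "f \<in> Hv v"
      unfolding Hv_def using f by (auto intro!: bdd_aboveI[of _ 1])
    ultimately show ?thesis
      by (auto simp: S_def)
  qed
  have "Sup S \<le> 1 / v (cmod z)"
    using fS upper by (intro cSup_least) auto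
  moreover have "cmod (f z) \<le> Sup S"
    by (rule cSup_upper[OF fS]) (rule bdd_aboveI, rule upper)
  moreover have "1 / (C * v (cmod z)) \<le> cmod (f z)"
    using f(3) C v_pos by (simp add: field_simps)
  moreover have "0 < 1 / (C * v (cmod z))"
    using C v_pos by simp
  ultimately have S: "1 / (C * v (cmod z)) \<le> Sup S" "Sup S \<le> 1 / v (cmod z)" "0 < Sup S"
    by linarith+
  have "associated_weight v z = 1 / Sup S"
    by (simp add: associated_weight_def S_def inverse_eq_divide)
  moreover have "v (cmod z) \<le> 1 / Sup S" "1 / Sup S \<le> C * v (cmod z)"
    using S C v_pos by (simp_all add: field_simps)
  ultimately show "v (cmod z) \<le> associated_weight v z" "associated_weight v z \<le> C * v (cmod z)"
    by simp_all
qed (use v C in auto)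

text \<open>In the variable \<open>u = ln s\<close> this is Taylor's formula at \<open>ln r\<close> for a function whose second
  derivative is at least \<open>c\<close>. The difference of the two sides has derivative
  \<open>(s f'(s) - r f'(r) - c ln (s / r)) / s\<close>, whose numerator is nondecreasing and vanishes at \<open>r\<close>;
  so the difference is smallest at \<open>s = r\<close>.\<close>

lemma log_uniformly_convex_above_parabola:
  fixes f f' f'' :: "real \<Rightarrow> real"
  assumes f: "\<And>x. x \<ge> r0 \<Longrightarrow> (f has_real_derivative f' x) (at x)"
    and f': "\<And>x. x \<ge> r0 \<Longrightarrow> (f' has_real_derivative f'' x) (at x)"
    and convex: "\<And>x. x \<ge> r0 \<Longrightarrow> f' x + x * f'' x \<ge> c / x"
    and r0: "r0 > 0" "r \<ge> r0" "s \<ge> r0"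
  shows "f r + r * f' r * ln (s / r) + c / 2 * (ln (s / r))\<^sup>2 \<le> f s"
proof -
  have r: "r > 0" using r0 by simp
  define N where "N = (\<lambda>x. x * f' x - r * f' r - c * ln (x / r))"
  define G where "G = (\<lambda>x. f x - r * f' r * ln (x / r) - c / 2 * (ln (x / r))\<^sup>2)"
  have N_mono: "N a \<le> N b" if "r0 \<le> a" "a \<le> b" for a b
  proof (rule DERIV_nonneg_imp_nondecreasing[OF that(2)])
    fix x assume "a \<le> x" "x \<le> b"
    then have x: "x \<ge> r0" "x > 0" using that r0 by auto
    have "(N has_real_derivative f' x + x * f'' x - c / x) (at x)"
      unfolding N_def using x r
      by (auto intro!: derivative_eq_intros f'[OF x(1)] simp: field_simps)
    then show "\<exists>y. (N has_real_derivative y) (at x) \<and> 0 \<le> y"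
      using convex[OF x(1)] by (intro exI conjI) auto
  qed
  have G_deriv: "(G has_real_derivative N x / x) (at x)" if "x \<ge> r0" for x
    using that r0 r unfolding G_def N_def
    by (auto intro!: derivative_eq_intros f[OF that] simp: field_simps)
  have N_r: "N r = 0"
    using r by (simp add: N_def)
  have "G r \<le> G s"
  proof (cases "r \<le> s")
    case True
    show ?thesis
    proof (rule DERIV_nonneg_imp_nondecreasing[OF True])
      fix x assume x: "r \<le> x" "x \<le> s"
      then have "N x / x \<ge> 0"
        using N_mono[of r x] N_r r0 by simp
      then show "\<exists>y. (G has_real_derivative y) (at x) \<and> 0 \<le> y"
        using G_deriv[of x] x r0 by (intro exI[of _ "N x / x"]) auto
    qed
  next
    case False
    show ?thesis
    proof (rule DERIV_nonpos_imp_nonincreasing[of s r G])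
      fix x assume x: "s \<le> x" "x \<le> r"
      then have "N x / x \<le> 0"
        using N_mono[of x r] N_r r0 by (simp add: divide_nonpos_pos)
      then show "\<exists>y. (G has_real_derivative y) (at x) \<and> y \<le> 0"
        using G_deriv[of x] x r0 by (intro exI[of _ "N x / x"]) auto
    qed (use False in simp)
  qed
  then show ?thesis
    using r by (simp add: G_def)
qed

text \<open>Replacing the slope \<open>r f'(r)\<close> by its integer part costs at most \<open>\<bar>L\<bar>\<close> with
  \<open>L = ln (s / r)\<close>, and \<open>c / 2 L\<^sup>2 - \<bar>L\<bar> \<ge> - 1 / (2 c)\<close> since
  \<open>(c \<bar>L\<bar> - 1)\<^sup>2 \<ge> 0\<close>.\<close>

lemma monomial_below_exp:
  fixes f f' f'' :: "real \<Rightarrow> real"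
  assumes f: "\<And>x. x \<ge> r0 \<Longrightarrow> (f has_real_derivative f' x) (at x)"
    and f': "\<And>x. x \<ge> r0 \<Longrightarrow> (f' has_real_derivative f'' x) (at x)"
    and convex: "\<And>x. x \<ge> r0 \<Longrightarrow> f' x + x * f'' x \<ge> c / x"
    and r0: "r0 > 0" "r \<ge> r0" "s \<ge> r0" and c: "c > 0" and f'_nonneg: "f' r \<ge> 0"
  shows "exp (f r - 1 / (2 * c)) * (s / r) ^ nat \<lfloor>r * f' r\<rfloor> \<le> exp (f s)"
proof -
  define n where "n = nat \<lfloor>r * f' r\<rfloor>"
  define L where "L = ln (s / r)"
  have "0 \<le> r * f' r"
    using r0 f'_nonneg by simp
  then have n: "\<bar>real n - r * f' r\<bar> \<le> 1"
    unfolding n_def by linarith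
  have "(real n - r * f' r) * L \<le> \<bar>L\<bar>"
    using mult_right_mono[OF n, of "\<bar>L\<bar>"] by (simp add: abs_mult[symmetric])
  moreover have "\<bar>L\<bar> \<le> c / 2 * L\<^sup>2 + 1 / (2 * c)"
  proof -
    have "0 \<le> (c * \<bar>L\<bar> - 1)\<^sup>2 / (2 * c)"
      using c by simp
    also have "\<dots> = c / 2 * L\<^sup>2 + 1 / (2 * c) - \<bar>L\<bar>"
      using c by (simp add: power2_diff power_mult_distrib field_simps power2_eq_square)
    finally show ?thesis by simp
  qed
  moreover have "f r + r * f' r * L + c / 2 * L\<^sup>2 \<le> f s"
    unfolding L_def by (rule log_uniformly_convex_above_parabola[OF f f' convex r0])
  ultimately have "f r - 1 / (2 * c) + real n * L \<le> f s"
    by (simp add: algebra_simps)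
  moreover have "(s / r) ^ n = exp (real n * L)"
    using r0 by (simp add: L_def exp_of_nat_mult)
  ultimately show ?thesis
    by (simp add: n_def[symmetric] exp_add[symmetric])
qed

text \<open>Lowering the monomial further by the factor \<open>e\<^bsup>- \<phi>(r0)\<^esup>\<close> brings it below \<open>1 \<le> e\<^sup>\<phi>\<close>
  at radius \<open>r0\<close>, hence on the whole disc inside, which the convexity hypothesis does not reach.\<close>

lemma essential_exp_minus:
  assumes phi: "C2_halfline phi phi' phi''"
    and nonneg: "\<And>r. r \<ge> 0 \<Longrightarrow> phi r \<ge> 0"
    and pos: "\<And>r. r > 0 \<Longrightarrow> phi' r > 0"
    and v: "\<And>r. r \<ge> 0 \<Longrightarrow> v r = exp (- phi r)"
    and weight: "weight v"
    and r0: "r0 > 0" and c: "c > 0"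
    and convex: "\<And>r. r \<ge> r0 \<Longrightarrow> phi' r + r * phi'' r \<ge> c / r"
  shows "essential v"
proof -
  define K where "K = 1 / (2 * c) + phi r0"
  have K: "K \<ge> phi r0"
    using c by (simp add: K_def)
  show ?thesis
  proof (rule essentialI[OF weight, of "exp K"])
    fix z :: complex
    define r where "r = cmod z"
    show "\<exists>f. f holomorphic_on UNIV \<and> (\<forall>w. v (cmod w) * cmod (f w) \<le> 1) \<and>
      1 \<le> exp K * v (cmod z) * cmod (f z)"
    proof (cases "r0 \<le> r")
      case False
      then have "phi r \<le> phi r0"
        using r0 by (intro mono_onD[OF C2_halfline_mono_on[OF phi pos]]) (auto simp: r_def)
      then have "1 \<le> exp K * v r"
        using K by (simp add: v r_def exp_add[symmetric])
      moreover have "v (cmod w) \<le> 1" for w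
        using nonneg by (simp add: v)
      ultimately show ?thesis
        by (intro exI[of _ "\<lambda>_. 1"]) (auto simp: r_def)
    next
      case True
      then have r: "r > 0" using r0 by simp
      define n where "n = nat \<lfloor>r * phi' r\<rfloor>"
      define f where "f = (\<lambda>w. of_real (exp (phi r - K)) * (w / of_real r) ^ n :: complex)"
      have norm_f: "cmod (f w) = exp (phi r - K) * (cmod w / r) ^ n" for w
        using r by (simp add: f_def norm_mult norm_power norm_divide)
      have far: "exp (phi r - 1 / (2 * c)) * (s / r) ^ n \<le> exp (phi s)" if "s \<ge> r0" for s
        unfolding n_def
        by (rule monomial_below_exp[where f' = phi', OF _ _ convex])
          (use C2_halfline_DERIV[OF phi] r0 True that c pos[OF r] in auto)
      have split: "exp (phi r - K) = exp (- phi r0) * exp (phi r - 1 / (2 * c))"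
        by (simp add: K_def exp_add[symmetric])
      have below: "exp (phi r - K) * (s / r) ^ n \<le> exp (phi s)" if s: "s \<ge> 0" for s
      proof (cases "s \<ge> r0")
        case True
        have "exp (phi r - K) * (s / r) ^ n \<le> exp (- phi r0) * exp (phi s)"
          using far[OF True] by (simp add: split mult.assoc)
        also have "\<dots> \<le> 1 * exp (phi s)"
          using nonneg[of r0] r0 by (intro mult_right_mono) auto
        finally show ?thesis by simp
      next
        case False
        have "exp (phi r - K) * (s / r) ^ n \<le> exp (phi r - K) * (r0 / r) ^ n"
          using False s r by (intro mult_left_mono power_mono divide_right_mono) auto
        also have "\<dots> \<le> exp (- phi r0) * exp (phi r0)"
          using far[of r0] by (simp add: split mult.assoc)
        also have "\<dots> \<le> exp (phi s)"
          using nonneg[OF s] by (simp add: exp_add[symmetric])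
        finally show ?thesis .
      qed
      have "f holomorphic_on UNIV"
        unfolding f_def using r by (intro holomorphic_intros) auto
      moreover have "v (cmod w) * cmod (f w) \<le> 1" for w
        using mult_left_mono[OF below[of "cmod w"], of "exp (- phi (cmod w))"]
        by (simp add: norm_f v exp_add[symmetric])
      moreover have "1 \<le> exp K * v (cmod z) * cmod (f z)"
        using r by (simp add: norm_f v exp_add[symmetric] flip: r_def)
      ultimately show ?thesis
        by blast
    qed
  qed simp
qed

section \<open>Regularity and essentiality of exponential weights\<close>

theorem lemma3p10:
  fixes phi phi' phi'' v :: "real \<Rightarrow> real" and R0 \<delta> :: real
  assumes phi_C2: "C2_halfline phi phi' phi''"
    and phi_nonneg: "\<And>r. r \<ge> 0 \<Longrightarrow> phi r \<ge> 0"
    and phi'_pos: "\<And>r. r \<ge> 0 \<Longrightarrow> phi' r > 0"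
    and phi'_lim: "filterlim (\<lambda>r. r * phi' r) at_top at_top"
    and R0: "R0 \<ge> 0"
    and delta: "0 < \<delta>" "\<delta> < 1"
    and phi''_le: "\<And>r. r \<ge> R0 \<Longrightarrow> phi'' r \<le> (1 - \<delta>) * (phi' r)\<^sup>2"
    and v: "\<And>r. r \<ge> 0 \<Longrightarrow> v r = exp (- phi r)"
  shows "weight v \<and>
    (\<exists>R C \<delta>'. R > 0 \<and> C > 0 \<and> 0 < \<delta>' \<and> \<delta>' \<le> 1 \<and>
       antimono_on {R<..} (\<lambda>r. \<bar>deriv v r\<bar> * r powr (1 + \<delta>')) \<and>
       (\<forall>r>R. - (v r * deriv (deriv v) r / (deriv v r)\<^sup>2) \<le> C)) \<and>
    ((\<exists>r0 c. r0 > 0 \<and> c > 0 \<and> (\<forall>r\<ge>r0. phi' r + r * phi'' r \<ge> c / r)) \<longrightarrow> essential v)"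
proof (intro conjI impI)
  have pos: "\<And>r. r > 0 \<Longrightarrow> phi' r > 0"
    using phi'_pos by simp
  show weight: "weight v"
    by (rule weight_exp_minus[OF phi_C2 pos phi'_lim v])
  obtain R where R: "R > 0" "antimono_on {R<..} (\<lambda>r. \<bar>deriv v r\<bar> * r\<^sup>2)"
      "\<And>r. r > R \<Longrightarrow> - (v r * deriv (deriv v) r / (deriv v r)\<^sup>2) \<le> - \<delta>"
    using regularity_exp_minus[OF phi_C2 pos phi'_lim delta(1) phi''_le v] by blast
  have "antimono_on {R<..} (\<lambda>r. \<bar>deriv v r\<bar> * r powr (1 + 1))"
    using R(1,2) by (auto simp: monotone_on_def)
  moreover have "- (v r * deriv (deriv v) r / (deriv v r)\<^sup>2) \<le> 1" if "r > R" for r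
    using R(3)[OF that] delta(1) by simp
  ultimately show "\<exists>R C \<delta>'. R > 0 \<and> C > 0 \<and> 0 < \<delta>' \<and> \<delta>' \<le> 1 \<and>
       antimono_on {R<..} (\<lambda>r. \<bar>deriv v r\<bar> * r powr (1 + \<delta>')) \<and>
       (\<forall>r>R. - (v r * deriv (deriv v) r / (deriv v r)\<^sup>2) \<le> C)"
    using R(1) by (intro exI[of _ R] exI[of _ 1]) auto
  assume "\<exists>r0 c. r0 > 0 \<and> c > 0 \<and> (\<forall>r\<ge>r0. phi' r + r * phi'' r \<ge> c / r)"
  then show "essential v"
    using essential_exp_minus[OF phi_C2 phi_nonneg pos v weight] by blast
qed

end
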